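(* Let $I_\iota$ be an $\iota$-implementation (of a global type $\mathcal G(\vec y)$ at $u$) and $\sigma$ a store. If $r\in\mathcal R\langle I_\iota,\sigma\rangle$ is a run of length $m$, then there is a sequence $\langle I_\iota,\sigma\rangle\overset{\alpha_1}{\hookrightarrow}\langle S_1,\sigma_1\rangle\cdots\overset{\alpha_n}{\hookrightarrow}\langle S_n,\sigma_n\rangle$ for which there is an order-preserving bijection $\chi$ between $\{1,\dots,m\}$ and $\{1\le j\le n:\alpha_j\text{ is not a }\tau\}$ such that, for every $i$, the $i$-th element of $r$ is an input of sort $d$ iff so is $\alpha_{\chi(i)}$, and the value in $\alpha_{\chi(i)}$ has the sort $d$.
   Context: **Names.** Fix pairwise disjoint infinite sets of shared names $\mathbb U\ni u$, session channels $\mathbb Y\ni y$, participants $\mathbb P\ni p,q$ (identified with the natural numbers), variables $\mathbb X\ni x$, values $\mathbb V\ni v$. Sorts $d$ are basic data types; $\vdash v:d$ means $v$ has sort $d$. $\vec y$ is a tuple of pairwise distinct session channels, also viewed as a set. Expressions: $e::=x\mid v\mid e_1\,\mathrm{bop}\,e_2\mid\mathrm{uop}\,e$; lists $\ell::=[e_1,\dots,e_n]\mid e_1..e_2$ (integer range); $\varepsilon$ is the empty list, $\mathrm{hd},\mathrm{tl}$ head and tail. A store $\sigma$ is a partial function from variables to values and from session channels to shared names; $e{\downarrow}\sigma$ is the value of $e$, defined iff the variables of $e$ are in $\mathrm{dom}\,\sigma$. **Global types.** $G::=\sum_{i\in I}p\to q_i:y_i\,d_i;G_i\mid G;G'\mid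 G^{*f}\mid\mathsf{end}$ ($f$ an injective partial map from participants to sorted channels $y\,d$); $\mathcal P(G)$ is the set of participants occurring in interactions of $G$; a global type is $\mathcal G(\vec y)\triangleq G$ with all channels of $G$ in $\vec y$, and $\mathcal P(\mathcal G)=\mathcal P(G)$. Only $\mathcal P(\mathcal G)$ and $\vec y$ are used below. **Processes and systems.** $P,Q::=\bar u^{n}(\vec y).P\mid u^{p}(\vec y).P\mid N\mid\bar y\,e\mid P;Q\mid\mathsf{if}\ e\ \mathsf{then}\ P\ \mathsf{else}\ Q\mid\mathsf{for}\ x\ \mathsf{in}\ \ell\ \mathsf{do}\ P\mid\mathsf{repeat}\ N\ \mathsf{until}\ N'$; $N::=\sum_{i\in I}y_i(x_i).P_i$ (distinct $y_i$; written $0$ if $I=\emptyset$); $S::=P\mid S|S'\mid y[\vec v]\mid(\nu\vec y@u)S$. $\vec y$ is bound in requests, accepts and $\nu$, $x_i$ in $P_i$, $x$ in the body of $\mathsf{for}$; $\mathrm{fn},\mathrm{fy},\mathrm{fx}$ are free names, free session channels, free variables, $\mathrm{bn}$ bound names. $\equiv$ is the least congruence containing $\alpha$-conversion, commutation of restrictions, $(\nu\vec y@u)0\equiv0$, $(\nu\vec y@u)(S|S')\equiv S|(\nu\vec y@u)S'$ if $\vec y\cap\mathrm{fy}(S)=\emptyset$, and making $|$ a commutative monoid and $;$ a monoid, both with unit $0$. Labels: $\alpha::=\bar u^n(\vec y)\mid u^p(\vec y)\mid\bar y\,v\mid y\,v\mid\tau\mid e\vdash\alpha$; $\alpha$ abbreviates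 $\mathrm{true}\vdash\alpha$ and $e\wedge e'\vdash\alpha$ abbreviates $e\vdash(e'\vdash\alpha)$. $\mathrm{fy}(\bar u^n(\vec y))=\mathrm{fy}(u^p(\vec y))=\{u\}$, $\mathrm{fy}(\bar y v)=\mathrm{fy}(yv)=\{y\}$, $\mathrm{fy}(\tau)=\emptyset$; $\mathrm{bn}$ is $\vec y$ for requests/accepts and $\emptyset$ otherwise; conditions are ignored; $\mathrm n(\alpha)=\mathrm{fy}(\alpha)\cup\mathrm{bn}(\alpha)$. Process transitions: $\langle\bar u^n(\vec y).P,\sigma\rangle\xrightarrow{\bar u^n(\vec y)}\langle P,\sigma[\vec y\mapsto u]\rangle$ and $\langle u^p(\vec y).P,\sigma\rangle\xrightarrow{u^p(\vec y)}\langle P,\sigma[\vec y\mapsto u]\rangle$ if $\vec y\cap\mathrm{dom}\,\sigma=\emptyset$; $\langle\bar y\,e,\sigma\rangle\xrightarrow{\bar y\,v}\langle0,\sigma\rangle$ if $e{\downarrow}\sigma=v$; $\langle\sum_{i\in I}y_i(x_i).P_i,\sigma\rangle\xrightarrow{y_j\,v}\langle P_j,\sigma[x_j\mapsto v]\rangle$ for $j\in I$; $\langle P;Q,\sigma\rangle\xrightarrow{e\vdash\alpha}\langle P';Q,\sigma'\rangle$ if $\langle P,\sigma\rangle\xrightarrow{e\vdash\alpha}\langle P',\sigma'\rangle$; $\langle\mathsf{if}\ e\ \mathsf{then}\ P\ \mathsf{else}\ Q,\sigma\rangle\xrightarrow{e\wedge e'\vdash\alpha}\langle P',\sigma'\rangle$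 if $e{\downarrow}\sigma=\mathrm{true}$ and $\langle P,\sigma\rangle\xrightarrow{e'\vdash\alpha}\langle P',\sigma'\rangle$; symmetrically with $\neg e\wedge e'$ and $Q$ if $e{\downarrow}\sigma=\mathrm{false}$; $\langle\mathsf{for}\ x\ \mathsf{in}\ \ell\ \mathsf{do}\ P,\sigma\rangle\xrightarrow{e\vdash\alpha}\langle P';\mathsf{for}\ x\ \mathsf{in}\ \mathrm{tl}(\ell)\ \mathsf{do}\ P,\sigma'\rangle$ if $\ell{\downarrow}\sigma\ne\varepsilon$ and $\langle P,\sigma[x\mapsto\mathrm{hd}(\ell{\downarrow}\sigma)]\rangle\xrightarrow{e\vdash\alpha}\langle P',\sigma'\rangle$; $\langle\mathsf{for}\ x\ \mathsf{in}\ \ell\ \mathsf{do}\ P,\sigma\rangle\xrightarrow{\tau}\langle0,\sigma\rangle$ if $\ell{\downarrow}\sigma=\varepsilon$; $\langle\mathsf{repeat}\ N\ \mathsf{until}\ M,\sigma\rangle\xrightarrow{e\vdash\alpha}\langle P;\mathsf{repeat}\ N\ \mathsf{until}\ M,\sigma'\rangle$ if $\langle N,\sigma\rangle\xrightarrow{e\vdash\alpha}\langle P,\sigma'\rangle$ and no guard channel of $M$ is in $\mathrm{fy}(\alpha)$; $\langle\mathsf{repeat}\ N\ \mathsf{until}\ M,\sigma\rangle\xrightarrow{e\vdash\alpha}\langle P,\sigma'\rangle$ if $\langle M,\sigma\rangle\xrightarrow{e\vdash\alpha}\langle P,\sigma'\rangle$. System transitions: (SInit) $\langle\bar u^n(\vec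 y).P_0|u^1(\vec y).P_1|\cdots|u^n(\vec y).P_n,\sigma\rangle\xrightarrow{\tau}\langle(\nu\vec y@u)(P_0|\cdots|P_n|\vec y[\,]),\sigma[\vec y\mapsto u]\rangle$ if $\vec y\cap\mathrm{dom}\,\sigma=\emptyset$ ($\vec y[\,]$: empty queues); (SCom$_1$) if $\langle P,\sigma\rangle\xrightarrow{e\vdash\bar yv}\langle P',\sigma'\rangle$ then $\langle P|y[\vec v],\sigma\rangle\xrightarrow{e\vdash\tau}\langle P'|y[\vec v\cdot v],\sigma'\rangle$; (SCom$_2$) if $\langle P,\sigma\rangle\xrightarrow{e\vdash yv}\langle P',\sigma'\rangle$ then $\langle P|y[v\cdot\vec v],\sigma\rangle\xrightarrow{e\vdash\tau}\langle P'|y[\vec v],\sigma'\rangle$; (SPar) if $\langle S_1,\sigma\rangle\xrightarrow{e\vdash\alpha}\langle S_1',\sigma'\rangle$, $\mathrm{bn}(\alpha)\cap\mathrm{dom}\,\sigma=\emptyset$ and $\mathrm{fx}(S_2)\cap(\mathrm{dom}\,\sigma'\setminus\mathrm{dom}\,\sigma)=\emptyset$ then $\langle S_1|S_2,\sigma\rangle\xrightarrow{e\vdash\alpha}\langle S_1'|S_2,\sigma'\rangle$; (SNew) if $\langle S,\sigma\rangle\xrightarrow{e\vdash\alpha}\langle S',\sigma'\rangle$ and $\vec y\cap\mathrm{fy}(\alpha)=\emptyset$ then $\langle(\nu\vec y@u)S,\sigma\rangle\xrightarrow{e\vdash\alpha}\langle(\nu\vec y@u)S',\sigma'\rangle$;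 closure under $\equiv$ on both sides. The relation $\hookrightarrow$ is induced by the same rules after replacing the $\tau$ in the conclusions of SCom$_1$ and SCom$_2$ with the output, respectively input, action of the premise. A label is "a $\tau$" if it is $\tau$ up to its condition. **Implementations.** $P$ uniquely plays role $p$ in $u$ if: $P=\bar u^n(\vec y).Q$, $u\notin\mathrm{fn}(Q)$, $p=0$; or $P=u^p(\vec y).Q$, $u\notin\mathrm{fn}(Q)$; or $P=\sum_{i\in I}y_i(x_i).Q_i$ with every $Q_i$ uniquely playing $p$ in $u$; or $P$ is a conditional both of whose branches do; or $P=Q_1;Q_2$ with one $Q_i$ doing so and $u$ not free in the other; or $P=\mathsf{repeat}\ Q_1\ \mathsf{until}\ Q_2$ with $Q_2$ doing so and $u\notin\mathrm{fn}(Q_1)$. Let $\iota$ map each $p_j\in\{p_0,\dots,p_n\}$ to a process and $P_\iota=\iota(p_0)|\cdots|\iota(p_n)$. An $\iota$-implementation of $\vec y$ at $u$ for $\{p_0,\dots,p_n\}$ is a system $I_\iota$ for which there is a context $C[\_]=(\nu\vec y_1@u_1)\cdots(\nu\vec y_h@u_h)(\_\,|\,S)$ with $u\notin\{u_1,\dots,u_h\}$, $(\{u\}\cup\vec y)\cap\mathrm{fn}(S)=\emptyset$, $\vec y\cap\bigcup_i\vec y_i=\emptyset$, and either $I_\iota\equiv C[P_\iota]$ with each $\iota(p_j)$ uniquely playing $p_j$ in $u$, or $I_\iota\equiv C[(\nu\vec y@u)(P_\iota\,|\,\vec y[\vec v_1,\dots,\vec v_k])]$ for some queue contents with $u\notin\mathrm{fn}(P_\iota)$.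 An $\iota$-implementation of $\mathcal G(\vec y)$ at $u$ is one for $\mathcal P(\mathcal G)$. **Runs of implementations.** Events are $\langle p,\bar y\,d\rangle$ (output of sort $d$) and $\langle p,y\,d\rangle$ (input of sort $d$); a run is a finite sequence of events. $\mathcal R\langle I_\iota,\sigma\rangle$ is defined inductively: REnd: $\epsilon$ if $\iota(p)=0$ for all $p\in\mathcal P(\mathcal G)$ and all queues on $\vec y$ in $I_\iota$ are empty; RSnd: $\langle p,\bar y\,d\rangle r$ if $\langle\iota(p),\sigma\rangle\xrightarrow{e\vdash\bar y\,v}\langle P,\sigma\rangle$, $y\in\vec y$, $\vdash v:d$, $\langle I_\iota,\sigma\rangle\xrightarrow{e\vdash\tau}\langle I_{\iota[p\mapsto P]},\sigma\rangle$ and $r\in\mathcal R\langle I_{\iota[p\mapsto P]},\sigma\rangle$; RRcv: $\langle p,y\,d\rangle r$ if $\langle\iota(p),\sigma\rangle\xrightarrow{e\vdash y\,v}\langle P,\sigma'\rangle$, $y\in\vec y$, $\vdash v:d$, $\langle I_\iota,\sigma\rangle\xrightarrow{e\vdash\tau}\langle I_{\iota[p\mapsto P]},\sigma'\rangle$ and $r\in\mathcal R\langle I_{\iota[p\mapsto P]},\sigma'\rangle$; RExt$_1$: $r$ if $\langle\iota(p),\sigma\rangle\xrightarrow{e\vdash\alpha}\langle P,\sigma'\rangle$, $\mathrm n(\alpha)\cap\vec y=\emptyset$, $\langle I_\iota,\sigma\rangle\xrightarrow{e'\vdash\beta}\langle I_{\iota[p\mapsto P]},\sigma'\rangle$, $u\notin\mathrm{fn}(\beta)$,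 $r\in\mathcal R\langle I_{\iota[p\mapsto P]},\sigma'\rangle$; RExt$_2$: $r$ if $\langle I_\iota,\sigma\rangle\xrightarrow{e'\vdash\beta}\langle I'_\iota,\sigma'\rangle$ with $I'_\iota$ an implementation with the same $\iota$ and $r\in\mathcal R\langle I'_\iota,\sigma'\rangle$; ROpen: $r$ if $\mathcal P(\mathcal G)=\{p_0,\dots,p_n\}$, $\langle\iota(p_0),\sigma\rangle\xrightarrow{e_0\vdash\bar u^n(\vec y)}\langle P_0,\sigma_0\rangle$, $\langle\iota(p_i),\sigma\rangle\xrightarrow{e_i\vdash u^i(\vec y)}\langle P_i,\sigma_i\rangle$ for $1\le i\le n$, $\iota'=\iota[p_0\mapsto P_0]\cdots[p_n\mapsto P_n]$, $\langle I_\iota,\sigma\rangle\xrightarrow{e\vdash\tau}\langle I_{\iota'},\sigma[\vec y\mapsto u]\rangle$ and $r\in\mathcal R\langle I_{\iota'},\sigma[\vec y\mapsto u]\rangle$.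
   Formalization: χ ranges only over non-τ labels that are communications of the session at u; in ↪, SNew treats a revealed communication as τ; in runs, RSnd/RRcv change the queues on y exactly by the recorded value, RExt rules leave them unchanged, ROpen makes them empty. *)

theory Defs
  imports "HOL-Library.Finite_Map" "HOL-Combinatorics.Transposition"
begin

section \<open>Names, values, expressions, stores\<close>

datatype shname = Shared nat
datatype chan = Chan nat
datatype var = Var nat
type_synonym part = nat

text \<open>Values contain at least the booleans (conditions) and the integers (ranges); the type
  parameter stands for all other basic data.  Sorts are an arbitrary type \<open>'d\<close>, and the sorting
  judgement is a parameter \<open>has_sort :: 'b val \<Rightarrow> 'd \<Rightarrow> bool\<close> of the definition of runs.\<close>

datatype 'b val = VBool bool | VInt int | VData 'b

text \<open>Operators are represented by their (total) interpretations, so that a value is defined iff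
  all variables are in the domain of the store.\<close>

datatype 'b expr =
    EVar var
  | EVal "'b val"
  | EBop "'b val \<Rightarrow> 'b val \<Rightarrow> 'b val" "'b expr" "'b expr"
  | EUop "'b val \<Rightarrow> 'b val" "'b expr"

datatype 'b lexpr = LList "'b expr list" | LRange "'b expr" "'b expr"

fun val_and :: "'b val \<Rightarrow> 'b val \<Rightarrow> 'b val" where
  "val_and (VBool a) (VBool b) = VBool (a \<and> b)"
| "val_and _ _ = VBool False"

fun val_not :: "'b val \<Rightarrow> 'b val" where
  "val_not (VBool a) = VBool (\<not> a)"
| "val_not _ = VBool False"

fun val_plus :: "'b val \<Rightarrow> 'b val \<Rightarrow> 'b val" where
  "val_plus (VInt i) (VInt j) = VInt (i + j)"
| "val_plus _ _ = VInt 0"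

abbreviation e_true :: "'b expr" where "e_true \<equiv> EVal (VBool True)"
abbreviation e_and :: "'b expr \<Rightarrow> 'b expr \<Rightarrow> 'b expr" where "e_and \<equiv> EBop val_and"
abbreviation e_not :: "'b expr \<Rightarrow> 'b expr" where "e_not \<equiv> EUop val_not"

record 'b store =
  vals :: "var \<rightharpoonup> 'b val"
  sess :: "chan \<rightharpoonup> shname"

definition set_var :: "'b store \<Rightarrow> var \<Rightarrow> 'b val \<Rightarrow> 'b store" where
  "set_var \<sigma> x v = \<sigma>\<lparr>vals := (vals \<sigma>)(x \<mapsto> v)\<rparr>"

definition set_sess :: "'b store \<Rightarrow> chan list \<Rightarrow> shname \<Rightarrow> 'b store" where
  "set_sess \<sigma> ys u = \<sigma>\<lparr>sess := (\<lambda>c. if c \<in> set ys then Some u else sess \<sigma> c)\<rparr>"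

primrec eval_e :: "'b store \<Rightarrow> 'b expr \<Rightarrow> 'b val option" where
  "eval_e \<sigma> (EVar x) = vals \<sigma> x"
| "eval_e \<sigma> (EVal v) = Some v"
| "eval_e \<sigma> (EBop f e1 e2) =
     Option.bind (eval_e \<sigma> e1) (\<lambda>v1. Option.bind (eval_e \<sigma> e2) (\<lambda>v2. Some (f v1 v2)))"
| "eval_e \<sigma> (EUop f e) = map_option f (eval_e \<sigma> e)"

fun eval_l :: "'b store \<Rightarrow> 'b lexpr \<Rightarrow> 'b val list option" where
  "eval_l \<sigma> (LList es) = those (map (eval_e \<sigma>) es)"
| "eval_l \<sigma> (LRange e1 e2) =
     (case (eval_e \<sigma> e1, eval_e \<sigma> e2) of
        (Some (VInt i), Some (VInt j)) \<Rightarrow> Some (map VInt [i..j])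
      | _ \<Rightarrow> None)"

text \<open>The tail is taken syntactically: a loop re-evaluates its list in the current store.\<close>

fun tl_l :: "'b lexpr \<Rightarrow> 'b lexpr" where
  "tl_l (LList es) = LList (tl es)"
| "tl_l (LRange e1 e2) = LRange (EBop val_plus e1 (EVal (VInt 1))) e2"


section \<open>Global types\<close>

text \<open>\<open>GChoice p [(q\<^sub>1, y\<^sub>1, d\<^sub>1, G\<^sub>1), \<dots>]\<close> is the sum of the \<open>p \<rightarrow> q\<^sub>i : y\<^sub>i d\<^sub>i ; G\<^sub>i\<close>.\<close>

datatype 'd gtype =
    GChoice part "(part \<times> chan \<times> 'd \<times> 'd gtype) list"
  | GSeq "'d gtype" "'d gtype"
  | GStar "'d gtype" "part \<rightharpoonup> chan \<times> 'd"
  | GEnd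

fun participants :: "'d gtype \<Rightarrow> part set" where
  "participants (GChoice p bs) =
     (\<Union>b \<in> set bs. {p, fst b} \<union> participants (snd (snd (snd b))))"
| "participants (GSeq G G') = participants G \<union> participants G'"
| "participants (GStar G f) = participants G"
| "participants GEnd = {}"

fun gchans :: "'d gtype \<Rightarrow> chan set" where
  "gchans (GChoice p bs) =
     (\<Union>b \<in> set bs. {fst (snd b)} \<union> gchans (snd (snd (snd b))))"
| "gchans (GSeq G G') = gchans G \<union> gchans G'"
| "gchans (GStar G f) = gchans G \<union> fst ` ran f"
| "gchans GEnd = {}"

fun wf_gtype :: "'d gtype \<Rightarrow> bool" where
  "wf_gtype (GChoice p bs) \<longleftrightarrow> (\<forall>b \<in> set bs. wf_gtype (snd (snd (snd b))))"
| "wf_gtype (GSeq G G') \<longleftrightarrow> wf_gtype G \<and> wf_gtype G'"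
| "wf_gtype (GStar G f) \<longleftrightarrow> wf_gtype G \<and> inj_on f (dom f)"
| "wf_gtype GEnd \<longleftrightarrow> True"

definition global_type :: "chan list \<Rightarrow> 'd gtype \<Rightarrow> bool" where
  "global_type ys G \<longleftrightarrow> distinct ys \<and> wf_gtype G \<and> gchans G \<subseteq> set ys"


section \<open>Processes and systems\<close>

text \<open>A guarded sum is a finite map from its (hence distinct) guard channels \<open>y\<^sub>i\<close> to the pairs
  \<open>(x\<^sub>i, P\<^sub>i)\<close>.\<close>

datatype 'b proc =
    Request shname nat "chan list" "'b proc"
  | Accept shname part "chan list" "'b proc"
  | Branch "(chan, var \<times> 'b proc) fmap"
  | Send chan "'b expr"
  | Seq "'b proc" "'b proc"
  | Cond "'b expr" "'b proc" "'b proc"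
  | For var "'b lexpr" "'b proc"
  | Repeat "(chan, var \<times> 'b proc) fmap" "(chan, var \<times> 'b proc) fmap"

type_synonym 'b branches = "(chan, var \<times> 'b proc) fmap"

abbreviation Nil_p :: "'b proc" where "Nil_p \<equiv> Branch fmempty"

datatype 'b sys =
    Proc "'b proc"
  | Par "'b sys" "'b sys"
  | Queue chan "'b val list"
  | Res "chan list" shname "'b sys"

definition par :: "'b sys list \<Rightarrow> 'b sys" where
  "par Ss = foldr Par Ss (Proc Nil_p)"

definition queues :: "chan list \<Rightarrow> (chan \<Rightarrow> 'b val list) \<Rightarrow> 'b sys" where
  "queues ys w = par (map (\<lambda>y. Queue y (w y)) ys)"


subsection \<open>Free names\<close>

primrec fx_e :: "'b expr \<Rightarrow> var set" where
  "fx_e (EVar x) = {x}"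
| "fx_e (EVal v) = {}"
| "fx_e (EBop f e1 e2) = fx_e e1 \<union> fx_e e2"
| "fx_e (EUop f e) = fx_e e"

primrec fx_l :: "'b lexpr \<Rightarrow> var set" where
  "fx_l (LList es) = (\<Union>e \<in> set es. fx_e e)"
| "fx_l (LRange e1 e2) = fx_e e1 \<union> fx_e e2"

primrec fn_p :: "'b proc \<Rightarrow> shname set" where
  "fn_p (Request u n ys P) = {u} \<union> fn_p P"
| "fn_p (Accept u p ys P) = {u} \<union> fn_p P"
| "fn_p (Branch N) = (\<Union>(x, A) \<in> fmran' (fmmap (map_prod id fn_p) N). A)"
| "fn_p (Send y e) = {}"
| "fn_p (Seq P Q) = fn_p P \<union> fn_p Q"
| "fn_p (Cond e P Q) = fn_p P \<union> fn_p Q"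
| "fn_p (For x l P) = fn_p P"
| "fn_p (Repeat N M) = (\<Union>(x, A) \<in> fmran' (fmmap (map_prod id fn_p) N). A)
     \<union> (\<Union>(x, A) \<in> fmran' (fmmap (map_prod id fn_p) M). A)"

primrec fy_p :: "'b proc \<Rightarrow> chan set" where
  "fy_p (Request u n ys P) = fy_p P - set ys"
| "fy_p (Accept u p ys P) = fy_p P - set ys"
| "fy_p (Branch N) =
     fset (fmdom N) \<union> (\<Union>(x, A) \<in> fmran' (fmmap (map_prod id fy_p) N). A)"
| "fy_p (Send y e) = {y}"
| "fy_p (Seq P Q) = fy_p P \<union> fy_p Q"
| "fy_p (Cond e P Q) = fy_p P \<union> fy_p Q"
| "fy_p (For x l P) = fy_p P"
| "fy_p (Repeat N M) =
     fset (fmdom N) \<union> (\<Union>(x, A) \<in> fmran' (fmmap (map_prod id fy_p) N). A)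
     \<union> fset (fmdom M) \<union> (\<Union>(x, A) \<in> fmran' (fmmap (map_prod id fy_p) M). A)"

primrec fx_p :: "'b proc \<Rightarrow> var set" where
  "fx_p (Request u n ys P) = fx_p P"
| "fx_p (Accept u p ys P) = fx_p P"
| "fx_p (Branch N) = (\<Union>(x, A) \<in> fmran' (fmmap (map_prod id fx_p) N). A - {x})"
| "fx_p (Send y e) = fx_e e"
| "fx_p (Seq P Q) = fx_p P \<union> fx_p Q"
| "fx_p (Cond e P Q) = fx_e e \<union> fx_p P \<union> fx_p Q"
| "fx_p (For x l P) = fx_l l \<union> (fx_p P - {x})"
| "fx_p (Repeat N M) = (\<Union>(x, A) \<in> fmran' (fmmap (map_prod id fx_p) N). A - {x})
     \<union> (\<Union>(x, A) \<in> fmran' (fmmap (map_prod id fx_p) M). A - {x})"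

text \<open>The restriction \<open>(\<nu> ys @ u)\<close> binds \<open>ys\<close> but not \<open>u\<close>.\<close>

primrec fn_s :: "'b sys \<Rightarrow> shname set" where
  "fn_s (Proc P) = fn_p P"
| "fn_s (Par S T) = fn_s S \<union> fn_s T"
| "fn_s (Queue y vs) = {}"
| "fn_s (Res ys u S) = {u} \<union> fn_s S"

primrec fy_s :: "'b sys \<Rightarrow> chan set" where
  "fy_s (Proc P) = fy_p P"
| "fy_s (Par S T) = fy_s S \<union> fy_s T"
| "fy_s (Queue y vs) = {y}"
| "fy_s (Res ys u S) = fy_s S - set ys"

primrec fx_s :: "'b sys \<Rightarrow> var set" where
  "fx_s (Proc P) = fx_p P"
| "fx_s (Par S T) = fx_s S \<union> fx_s T"
| "fx_s (Queue y vs) = {}"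
| "fx_s (Res ys u S) = fx_s S"


subsection \<open>Structural congruence\<close>

text \<open>Alpha-conversion is expressed by name swapping: exchanging throughout a term two names
  that are not free in it renames bound names only and cannot capture.\<close>

primrec swapx_e :: "var \<Rightarrow> var \<Rightarrow> 'b expr \<Rightarrow> 'b expr" where
  "swapx_e a b (EVar x) = EVar (transpose a b x)"
| "swapx_e a b (EVal v) = EVal v"
| "swapx_e a b (EBop f e1 e2) = EBop f (swapx_e a b e1) (swapx_e a b e2)"
| "swapx_e a b (EUop f e) = EUop f (swapx_e a b e)"

primrec swapx_l :: "var \<Rightarrow> var \<Rightarrow> 'b lexpr \<Rightarrow> 'b lexpr" where
  "swapx_l a b (LList es) = LList (map (swapx_e a b) es)"
| "swapx_l a b (LRange e1 e2) = LRange (swapx_e a b e1) (swapx_e a b e2)"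

primrec swapx :: "var \<Rightarrow> var \<Rightarrow> 'b proc \<Rightarrow> 'b proc" where
  "swapx a b (Request u n ys P) = Request u n ys (swapx a b P)"
| "swapx a b (Accept u p ys P) = Accept u p ys (swapx a b P)"
| "swapx a b (Branch N) = Branch (fmmap (map_prod (transpose a b) (swapx a b)) N)"
| "swapx a b (Send y e) = Send y (swapx_e a b e)"
| "swapx a b (Seq P Q) = Seq (swapx a b P) (swapx a b Q)"
| "swapx a b (Cond e P Q) = Cond (swapx_e a b e) (swapx a b P) (swapx a b Q)"
| "swapx a b (For x l P) = For (transpose a b x) (swapx_l a b l) (swapx a b P)"
| "swapx a b (Repeat N M) = Repeat (fmmap (map_prod (transpose a b) (swapx a b)) N)
     (fmmap (map_prod (transpose a b) (swapx a b)) M)"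

context
  includes fmap.lifting
begin

lift_definition swap_keys :: "'k \<Rightarrow> 'k \<Rightarrow> ('k, 'v) fmap \<Rightarrow> ('k, 'v) fmap"
  is "\<lambda>a b m k. m (transpose a b k)"
proof -
  fix a b :: 'k and m :: "'k \<rightharpoonup> 'v"
  assume "finite (dom m)"
  then have "finite (transpose a b ` dom m)" by simp
  moreover have "dom (\<lambda>k. m (transpose a b k)) \<subseteq> transpose a b ` dom m"
    by (force simp: image_iff intro: transpose_involutory[symmetric])
  ultimately show "finite (dom (\<lambda>k. m (transpose a b k)))"
    using finite_subset by blast
qed

end

primrec swapy :: "chan \<Rightarrow> chan \<Rightarrow> 'b proc \<Rightarrow> 'b proc" where
  "swapy a b (Request u n ys P) = Request u n (map (transpose a b) ys) (swapy a b P)"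
| "swapy a b (Accept u p ys P) = Accept u p (map (transpose a b) ys) (swapy a b P)"
| "swapy a b (Branch N) = Branch (swap_keys a b (fmmap (map_prod id (swapy a b)) N))"
| "swapy a b (Send y e) = Send (transpose a b y) e"
| "swapy a b (Seq P Q) = Seq (swapy a b P) (swapy a b Q)"
| "swapy a b (Cond e P Q) = Cond e (swapy a b P) (swapy a b Q)"
| "swapy a b (For x l P) = For x l (swapy a b P)"
| "swapy a b (Repeat N M) = Repeat (swap_keys a b (fmmap (map_prod id (swapy a b)) N))
     (swap_keys a b (fmmap (map_prod id (swapy a b)) M))"

primrec swapy_s :: "chan \<Rightarrow> chan \<Rightarrow> 'b sys \<Rightarrow> 'b sys" where
  "swapy_s a b (Proc P) = Proc (swapy a b P)"
| "swapy_s a b (Par S T) = Par (swapy_s a b S) (swapy_s a b T)"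
| "swapy_s a b (Queue y vs) = Queue (transpose a b y) vs"
| "swapy_s a b (Res ys u S) = Res (map (transpose a b) ys) u (swapy_s a b S)"

text \<open>\<open>bcong\<close> rewrites one branch of a guarded sum: either its continuation or its bound
  variable.\<close>

inductive pcong :: "'b proc \<Rightarrow> 'b proc \<Rightarrow> bool"
  and bcong :: "'b branches \<Rightarrow> 'b branches \<Rightarrow> bool"
where
  p_refl: "pcong P P"
| p_sym: "pcong P Q \<Longrightarrow> pcong Q P"
| p_trans: "pcong P Q \<Longrightarrow> pcong Q R \<Longrightarrow> pcong P R"
| p_request: "pcong P P' \<Longrightarrow> pcong (Request u n ys P) (Request u n ys P')"
| p_accept: "pcong P P' \<Longrightarrow> pcong (Accept u p ys P) (Accept u p ys P')"
| p_branch: "bcong N N' \<Longrightarrow> pcong (Branch N) (Branch N')"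
| p_seq: "pcong P P' \<Longrightarrow> pcong Q Q' \<Longrightarrow> pcong (Seq P Q) (Seq P' Q')"
| p_cond: "pcong P P' \<Longrightarrow> pcong Q Q' \<Longrightarrow> pcong (Cond e P Q) (Cond e P' Q')"
| p_for: "pcong P P' \<Longrightarrow> pcong (For x l P) (For x l P')"
| p_repeat1: "bcong N N' \<Longrightarrow> pcong (Repeat N M) (Repeat N' M)"
| p_repeat2: "bcong M M' \<Longrightarrow> pcong (Repeat N M) (Repeat N M')"
| p_alpha_y: "a \<notin> fy_p P \<Longrightarrow> b \<notin> fy_p P \<Longrightarrow> pcong P (swapy a b P)"
| p_alpha_for: "b \<notin> fx_p P \<Longrightarrow> pcong (For x l P) (For b l (swapx x b P))"
| p_unit_l: "pcong (Seq Nil_p P) P"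
| p_unit_r: "pcong (Seq P Nil_p) P"
| p_assoc: "pcong (Seq (Seq P Q) R) (Seq P (Seq Q R))"
| b_cong: "fmlookup N y = Some (x, P) \<Longrightarrow> pcong P P' \<Longrightarrow> bcong N (fmupd y (x, P') N)"
| b_alpha: "fmlookup N y = Some (x, P) \<Longrightarrow> b \<notin> fx_p P
    \<Longrightarrow> bcong N (fmupd y (b, swapx x b P) N)"

text \<open>In \<open>s_res_comm\<close> the two tuples are disjoint; otherwise, exchanging the binders would capture
  (by alpha-conversion bound channels can always be made disjoint first).\<close>

inductive scong :: "'b sys \<Rightarrow> 'b sys \<Rightarrow> bool"
where
  s_refl: "scong S S"
| s_sym: "scong S T \<Longrightarrow> scong T S"
| s_trans: "scong S T \<Longrightarrow> scong T U \<Longrightarrow> scong S U"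
| s_proc: "pcong P P' \<Longrightarrow> scong (Proc P) (Proc P')"
| s_par: "scong S S' \<Longrightarrow> scong T T' \<Longrightarrow> scong (Par S T) (Par S' T')"
| s_res: "scong S S' \<Longrightarrow> scong (Res ys u S) (Res ys u S')"
| s_alpha: "a \<notin> fy_s S \<Longrightarrow> b \<notin> fy_s S \<Longrightarrow> scong S (swapy_s a b S)"
| s_unit: "scong (Par S (Proc Nil_p)) S"
| s_comm: "scong (Par S T) (Par T S)"
| s_assoc: "scong (Par (Par S T) U) (Par S (Par T U))"
| s_res_comm: "set ys \<inter> set zs = {} \<Longrightarrow> scong (Res ys u (Res zs u' S)) (Res zs u' (Res ys u S))"
| s_res_nil: "scong (Res ys u (Proc Nil_p)) (Proc Nil_p)"
| s_res_par: "set ys \<inter> fy_s S = {} \<Longrightarrow> scong (Res ys u (Par S T)) (Par S (Res ys u T))"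


section \<open>Transitions\<close>

text \<open>A label \<open>e \<turnstile> \<alpha>\<close> is represented by the condition \<open>e\<close> and the action \<open>\<alpha>\<close>, as two consecutive
  arguments of the transition relations.\<close>

datatype 'b act =
    ARequest shname nat "chan list"
  | AAccept shname part "chan list"
  | AOut chan "'b val"
  | AIn chan "'b val"
  | ATau

primrec fn_a :: "'b act \<Rightarrow> shname set" where
  "fn_a (ARequest u n ys) = {u}"
| "fn_a (AAccept u p ys) = {u}"
| "fn_a (AOut y v) = {}"
| "fn_a (AIn y v) = {}"
| "fn_a ATau = {}"

primrec fy_a :: "'b act \<Rightarrow> chan set" where
  "fy_a (ARequest u n ys) = {}"
| "fy_a (AAccept u p ys) = {}"
| "fy_a (AOut y v) = {y}"
| "fy_a (AIn y v) = {y}"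
| "fy_a ATau = {}"

primrec bn_a :: "'b act \<Rightarrow> chan set" where
  "bn_a (ARequest u n ys) = set ys"
| "bn_a (AAccept u p ys) = set ys"
| "bn_a (AOut y v) = {}"
| "bn_a (AIn y v) = {}"
| "bn_a ATau = {}"

inductive pstep ::
  "'b proc \<Rightarrow> 'b store \<Rightarrow> 'b expr \<Rightarrow> 'b act \<Rightarrow> 'b proc \<Rightarrow> 'b store \<Rightarrow> bool"
where
  PRequest: "set ys \<inter> dom (sess \<sigma>) = {} \<Longrightarrow>
    pstep (Request u n ys P) \<sigma> e_true (ARequest u n ys) P (set_sess \<sigma> ys u)"
| PAccept: "set ys \<inter> dom (sess \<sigma>) = {} \<Longrightarrow>
    pstep (Accept u p ys P) \<sigma> e_true (AAccept u p ys) P (set_sess \<sigma> ys u)"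
| PSend: "eval_e \<sigma> e = Some v \<Longrightarrow>
    pstep (Send y e) \<sigma> e_true (AOut y v) Nil_p \<sigma>"
| PReceive: "fmlookup N y = Some (x, P) \<Longrightarrow>
    pstep (Branch N) \<sigma> e_true (AIn y v) P (set_var \<sigma> x v)"
| PSeq: "pstep P \<sigma> e \<alpha> P' \<sigma>' \<Longrightarrow>
    pstep (Seq P Q) \<sigma> e \<alpha> (Seq P' Q) \<sigma>'"
| PThen: "eval_e \<sigma> e = Some (VBool True) \<Longrightarrow> pstep P \<sigma> e' \<alpha> P' \<sigma>' \<Longrightarrow>
    pstep (Cond e P Q) \<sigma> (e_and e e') \<alpha> P' \<sigma>'"
| PElse: "eval_e \<sigma> e = Some (VBool False) \<Longrightarrow> pstep Q \<sigma> e' \<alpha> Q' \<sigma>' \<Longrightarrow>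
    pstep (Cond e P Q) \<sigma> (e_and (e_not e) e') \<alpha> Q' \<sigma>'"
| PFor: "eval_l \<sigma> l = Some vs \<Longrightarrow> vs \<noteq> [] \<Longrightarrow> pstep P (set_var \<sigma> x (hd vs)) e \<alpha> P' \<sigma>' \<Longrightarrow>
    pstep (For x l P) \<sigma> e \<alpha> (Seq P' (For x (tl_l l) P)) \<sigma>'"
| PForEnd: "eval_l \<sigma> l = Some [] \<Longrightarrow>
    pstep (For x l P) \<sigma> e_true ATau Nil_p \<sigma>"
| PRepeat: "pstep (Branch N) \<sigma> e \<alpha> P \<sigma>' \<Longrightarrow> fset (fmdom M) \<inter> fy_a \<alpha> = {} \<Longrightarrow>
    pstep (Repeat N M) \<sigma> e \<alpha> (Seq P (Repeat N M)) \<sigma>'"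
| PUntil: "pstep (Branch M) \<sigma> e \<alpha> P \<sigma>' \<Longrightarrow>
    pstep (Repeat N M) \<sigma> e \<alpha> P \<sigma>'"

text \<open>\<open>step\<close> is the transition relation of systems; processes are systems (\<open>SProc\<close>).\<close>

inductive step ::
  "'b sys \<Rightarrow> 'b store \<Rightarrow> 'b expr \<Rightarrow> 'b act \<Rightarrow> 'b sys \<Rightarrow> 'b store \<Rightarrow> bool"
where
  SProc: "pstep P \<sigma> e \<alpha> P' \<sigma>' \<Longrightarrow>
    step (Proc P) \<sigma> e \<alpha> (Proc P') \<sigma>'"
| SInit: "set ys \<inter> dom (sess \<sigma>) = {} \<Longrightarrow>
    step (Par (Proc (Request u n ys (P 0))) (par (map (\<lambda>i. Proc (Accept u i ys (P i))) [1..<Suc n]))) \<sigma>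
      e_true ATau
      (Res ys u (Par (par (map (\<lambda>i. Proc (P i)) [0..<Suc n])) (queues ys (\<lambda>_. []))))
      (set_sess \<sigma> ys u)"
| SCom1: "pstep P \<sigma> e (AOut y v) P' \<sigma>' \<Longrightarrow>
    step (Par (Proc P) (Queue y vs)) \<sigma> e ATau (Par (Proc P') (Queue y (vs @ [v]))) \<sigma>'"
| SCom2: "pstep P \<sigma> e (AIn y v) P' \<sigma>' \<Longrightarrow>
    step (Par (Proc P) (Queue y (v # vs))) \<sigma> e ATau (Par (Proc P') (Queue y vs)) \<sigma>'"
| SPar: "step S \<sigma> e \<alpha> S' \<sigma>' \<Longrightarrow> bn_a \<alpha> \<inter> dom (sess \<sigma>) = {} \<Longrightarrow>
    fx_s T \<inter> (dom (vals \<sigma>') - dom (vals \<sigma>)) = {} \<Longrightarrow>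
    step (Par S T) \<sigma> e \<alpha> (Par S' T) \<sigma>'"
| SNew: "step S \<sigma> e \<alpha> S' \<sigma>' \<Longrightarrow> set ys \<inter> fy_a \<alpha> = {} \<Longrightarrow>
    step (Res ys u S) \<sigma> e \<alpha> (Res ys u S') \<sigma>'"
| SCong: "scong S T \<Longrightarrow> step T \<sigma> e \<alpha> T' \<sigma>' \<Longrightarrow> scong T' S' \<Longrightarrow>
    step S \<sigma> e \<alpha> S' \<sigma>'"


subsection \<open>Transitions with revealed communications\<close>

text \<open>In the labels of \<open>hook\<close>, \<open>Comm w \<alpha>\<close> is the input or output \<open>\<alpha>\<close> put in place of the \<open>\<tau>\<close> of
  \<open>SCom1\<close> and \<open>SCom2\<close>; all other labels are \<open>Plain \<alpha>\<close>.  A revealed \<open>Comm\<close> is still an internal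
  move: like the \<open>\<tau>\<close> it replaces, it has no free names for the side condition of \<open>SNew\<close>, hence
  it is visible outside the restriction of its session.  (If that condition were applied to the
  revealed action, communications on restricted channels, i.e. all those of an established
  session, would have no counterpart in \<open>hook\<close>.)  As channels can be alpha-converted
  under a restriction, the component \<open>w\<close> records the session of the communication: it is \<open>None\<close>
  as long as the channel is free and \<open>Some u\<close> once its binder \<open>(\<nu> ys @ u)\<close> has been crossed.\<close>

datatype 'b hlabel = Plain "'b act" | Comm "shname option" "'b act"

fun cross :: "chan list \<Rightarrow> shname \<Rightarrow> shname option \<Rightarrow> 'b act \<Rightarrow> shname option" where
  "cross ys u None \<alpha> = (if fy_a \<alpha> \<subseteq> set ys then Some u else None)"
| "cross ys u (Some w) \<alpha> = Some w"

inductive hook ::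
  "'b sys \<Rightarrow> 'b store \<Rightarrow> 'b expr \<Rightarrow> 'b hlabel \<Rightarrow> 'b sys \<Rightarrow> 'b store \<Rightarrow> bool"
where
  HProc: "pstep P \<sigma> e \<alpha> P' \<sigma>' \<Longrightarrow>
    hook (Proc P) \<sigma> e (Plain \<alpha>) (Proc P') \<sigma>'"
| HInit: "set ys \<inter> dom (sess \<sigma>) = {} \<Longrightarrow>
    hook (Par (Proc (Request u n ys (P 0))) (par (map (\<lambda>i. Proc (Accept u i ys (P i))) [1..<Suc n]))) \<sigma>
      e_true (Plain ATau)
      (Res ys u (Par (par (map (\<lambda>i. Proc (P i)) [0..<Suc n])) (queues ys (\<lambda>_. []))))
      (set_sess \<sigma> ys u)"
| HCom1: "pstep P \<sigma> e (AOut y v) P' \<sigma>' \<Longrightarrow>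
    hook (Par (Proc P) (Queue y vs)) \<sigma> e (Comm None (AOut y v))
      (Par (Proc P') (Queue y (vs @ [v]))) \<sigma>'"
| HCom2: "pstep P \<sigma> e (AIn y v) P' \<sigma>' \<Longrightarrow>
    hook (Par (Proc P) (Queue y (v # vs))) \<sigma> e (Comm None (AIn y v))
      (Par (Proc P') (Queue y vs)) \<sigma>'"
| HPar: "hook S \<sigma> e l S' \<sigma>' \<Longrightarrow> (\<And>\<alpha>. l = Plain \<alpha> \<Longrightarrow> bn_a \<alpha> \<inter> dom (sess \<sigma>) = {}) \<Longrightarrow>
    fx_s T \<inter> (dom (vals \<sigma>') - dom (vals \<sigma>)) = {} \<Longrightarrow>
    hook (Par S T) \<sigma> e l (Par S' T) \<sigma>'"
| HNew: "hook S \<sigma> e (Plain \<alpha>) S' \<sigma>' \<Longrightarrow> set ys \<inter> fy_a \<alpha> = {} \<Longrightarrow>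
    hook (Res ys u S) \<sigma> e (Plain \<alpha>) (Res ys u S') \<sigma>'"
| HNewComm: "hook S \<sigma> e (Comm w \<alpha>) S' \<sigma>' \<Longrightarrow>
    hook (Res ys u S) \<sigma> e (Comm (cross ys u w \<alpha>) \<alpha>) (Res ys u S') \<sigma>'"
| HCong: "scong S T \<Longrightarrow> hook T \<sigma> e l T' \<sigma>' \<Longrightarrow> scong T' S' \<Longrightarrow>
    hook S \<sigma> e l S' \<sigma>'"

definition is_tau :: "'b hlabel \<Rightarrow> bool" where
  "is_tau l \<longleftrightarrow> l = Plain ATau"

text \<open>Visible actions, and communications of sessions other than the one at \<open>u\<close>.  The rules for
  runs ignore such steps (\<open>RExt1\<close>, \<open>RExt2\<close>) although their labels need not be \<open>\<tau>\<close>.\<close>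

definition external :: "shname \<Rightarrow> 'b hlabel \<Rightarrow> bool" where
  "external u l \<longleftrightarrow> (\<exists>\<alpha>. l = Plain \<alpha> \<and> \<alpha> \<noteq> ATau) \<or> (\<exists>w \<alpha>. l = Comm w \<alpha> \<and> w \<noteq> Some u)"

fun label_act :: "'b hlabel \<Rightarrow> 'b act" where
  "label_act (Plain \<alpha>) = \<alpha>"
| "label_act (Comm w \<alpha>) = \<alpha>"


section \<open>Implementations\<close>

inductive plays :: "part \<Rightarrow> shname \<Rightarrow> 'b proc \<Rightarrow> bool"
  for p :: part and u :: shname
where
  "p = 0 \<Longrightarrow> u \<notin> fn_p Q \<Longrightarrow> plays p u (Request u n ys Q)"
| "u \<notin> fn_p Q \<Longrightarrow> plays p u (Accept u p ys Q)"
| "(\<And>y x Q. fmlookup N y = Some (x, Q) \<Longrightarrow> plays p u Q) \<Longrightarrow> plays p u (Branch N)"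
| "plays p u P \<Longrightarrow> plays p u Q \<Longrightarrow> plays p u (Cond e P Q)"
| "plays p u P \<Longrightarrow> u \<notin> fn_p Q \<Longrightarrow> plays p u (Seq P Q)"
| "plays p u Q \<Longrightarrow> u \<notin> fn_p P \<Longrightarrow> plays p u (Seq P Q)"
| "plays p u (Branch M) \<Longrightarrow> u \<notin> fn_p (Branch N) \<Longrightarrow> plays p u (Repeat N M)"

text \<open>\<open>in_ctx ys u H I\<close>: the system \<open>I\<close> is congruent to \<open>C[H]\<close> for an admissible context \<open>C\<close>.\<close>

definition in_ctx :: "chan list \<Rightarrow> shname \<Rightarrow> 'b sys \<Rightarrow> 'b sys \<Rightarrow> bool" where
  "in_ctx ys u H I \<longleftrightarrow> (\<exists>bs S.
     scong I (foldr (\<lambda>(zs, w). Res zs w) bs (Par H S)) \<and>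
     u \<notin> snd ` set bs \<and> u \<notin> fn_s S \<and> set ys \<inter> fy_s S = {} \<and>
     (\<forall>b \<in> set bs. set ys \<inter> set (fst b) = {}))"

text \<open>\<open>impl A ys u \<iota> q I\<close>: the system \<open>I\<close> is an \<open>\<iota>\<close>-implementation of \<open>ys\<close> at \<open>u\<close> for the set \<open>A\<close> of
  participants.  The session is not yet open if \<open>q = None\<close>; it is open with queue contents \<open>w\<close>
  if \<open>q = Some w\<close>.\<close>

fun impl :: "part set \<Rightarrow> chan list \<Rightarrow> shname \<Rightarrow> (part \<Rightarrow> 'b proc)
  \<Rightarrow> (chan \<Rightarrow> 'b val list) option \<Rightarrow> 'b sys \<Rightarrow> bool"
where
  "impl A ys u \<iota> None I \<longleftrightarrow> (\<exists>ps. distinct ps \<and> set ps = A \<and>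
     in_ctx ys u (par (map (\<lambda>p. Proc (\<iota> p)) ps)) I \<and> (\<forall>p \<in> A. plays p u (\<iota> p)))"
| "impl A ys u \<iota> (Some w) I \<longleftrightarrow> (\<exists>ps. distinct ps \<and> set ps = A \<and>
     in_ctx ys u (Res ys u (Par (par (map (\<lambda>p. Proc (\<iota> p)) ps)) (queues ys w))) I \<and>
     (\<forall>p \<in> A. u \<notin> fn_p (\<iota> p)))"

definition implementation ::
  "'d gtype \<Rightarrow> chan list \<Rightarrow> shname \<Rightarrow> (part \<Rightarrow> 'b proc) \<Rightarrow> 'b sys \<Rightarrow> bool"
where
  "implementation G ys u \<iota> I \<longleftrightarrow> (\<exists>q. impl (participants G) ys u \<iota> q I)"


section \<open>Runs of implementations\<close>

datatype 'd event = EvOut part chan 'd | EvIn part chan 'd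

fun event_sort :: "'d event \<Rightarrow> 'd" where
  "event_sort (EvOut p y d) = d"
| "event_sort (EvIn p y d) = d"

text \<open>The system written \<open>I\<close> with subscript \<open>\<iota>[p \<mapsto> P]\<close> in the rules is the implementation reached by
  the step of \<open>p\<close>.  An implementation is determined by \<open>\<iota>\<close>, its context and the contents of the
  queues on \<open>ys\<close>; the rules therefore fix what the step does to these queues: an output appends
  the value, an input removes it, an external step does not change them, and opening the
  session creates them empty.  The context may change freely.\<close>

inductive run ::
  "('b val \<Rightarrow> 'd \<Rightarrow> bool) \<Rightarrow> part set \<Rightarrow> chan list \<Rightarrow> shname
    \<Rightarrow> (part \<Rightarrow> 'b proc) \<Rightarrow> 'b sys \<Rightarrow> 'b store \<Rightarrow> 'd event list \<Rightarrow> bool"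
  for has_sort :: "'b val \<Rightarrow> 'd \<Rightarrow> bool" and A :: "part set"
    and ys :: "chan list" and u :: shname
where
  REnd: "impl A ys u \<iota> q I \<Longrightarrow> (\<forall>p \<in> A. \<iota> p = Nil_p) \<Longrightarrow>
    (\<forall>w. q = Some w \<longrightarrow> (\<forall>y \<in> set ys. w y = [])) \<Longrightarrow>
    run has_sort A ys u \<iota> I \<sigma> []"
| RSnd: "impl A ys u \<iota> (Some w) I \<Longrightarrow> p \<in> A \<Longrightarrow>
    step (Proc (\<iota> p)) \<sigma> e (AOut y v) (Proc P) \<sigma> \<Longrightarrow> y \<in> set ys \<Longrightarrow> has_sort v d \<Longrightarrow>
    step I \<sigma> e ATau I' \<sigma> \<Longrightarrow> impl A ys u (\<iota>(p := P)) (Some (w(y := w y @ [v]))) I' \<Longrightarrow>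
    run has_sort A ys u (\<iota>(p := P)) I' \<sigma> r \<Longrightarrow>
    run has_sort A ys u \<iota> I \<sigma> (EvOut p y d # r)"
| RRcv: "impl A ys u \<iota> (Some w) I \<Longrightarrow> p \<in> A \<Longrightarrow>
    step (Proc (\<iota> p)) \<sigma> e (AIn y v) (Proc P) \<sigma>' \<Longrightarrow> y \<in> set ys \<Longrightarrow> has_sort v d \<Longrightarrow>
    w y = v # vs \<Longrightarrow>
    step I \<sigma> e ATau I' \<sigma>' \<Longrightarrow> impl A ys u (\<iota>(p := P)) (Some (w(y := vs))) I' \<Longrightarrow>
    run has_sort A ys u (\<iota>(p := P)) I' \<sigma>' r \<Longrightarrow>
    run has_sort A ys u \<iota> I \<sigma> (EvIn p y d # r)"
| RExt1: "impl A ys u \<iota> q I \<Longrightarrow> p \<in> A \<Longrightarrow>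
    step (Proc (\<iota> p)) \<sigma> e \<alpha> (Proc P) \<sigma>' \<Longrightarrow> (fy_a \<alpha> \<union> bn_a \<alpha>) \<inter> set ys = {} \<Longrightarrow>
    step I \<sigma> e' \<beta> I' \<sigma>' \<Longrightarrow> u \<notin> fn_a \<beta> \<Longrightarrow> impl A ys u (\<iota>(p := P)) q I' \<Longrightarrow>
    run has_sort A ys u (\<iota>(p := P)) I' \<sigma>' r \<Longrightarrow>
    run has_sort A ys u \<iota> I \<sigma> r"
| RExt2: "impl A ys u \<iota> q I \<Longrightarrow>
    step I \<sigma> e' \<beta> I' \<sigma>' \<Longrightarrow> impl A ys u \<iota> q I' \<Longrightarrow>
    run has_sort A ys u \<iota> I' \<sigma>' r \<Longrightarrow>
    run has_sort A ys u \<iota> I \<sigma> r"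
| ROpen: "impl A ys u \<iota> None I \<Longrightarrow> distinct ps \<Longrightarrow> set ps = A \<Longrightarrow> length ps = Suc n \<Longrightarrow>
    step (Proc (\<iota> (ps ! 0))) \<sigma> (es 0) (ARequest u n ys) (Proc (Ps 0)) (ss 0) \<Longrightarrow>
    (\<forall>i \<in> {1..n}. step (Proc (\<iota> (ps ! i))) \<sigma> (es i) (AAccept u i ys) (Proc (Ps i)) (ss i)) \<Longrightarrow>
    (\<forall>i \<le> n. \<iota>' (ps ! i) = Ps i) \<Longrightarrow> (\<forall>p. p \<notin> A \<longrightarrow> \<iota>' p = \<iota> p) \<Longrightarrow>
    step I \<sigma> e ATau I' (set_sess \<sigma> ys u) \<Longrightarrow> impl A ys u \<iota>' (Some (\<lambda>_. [])) I' \<Longrightarrow>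
    run has_sort A ys u \<iota>' I' (set_sess \<sigma> ys u) r \<Longrightarrow>
    run has_sort A ys u \<iota> I \<sigma> r"

definition runs ::
  "('b val \<Rightarrow> 'd \<Rightarrow> bool) \<Rightarrow> 'd gtype \<Rightarrow> chan list \<Rightarrow> shname
    \<Rightarrow> (part \<Rightarrow> 'b proc) \<Rightarrow> 'b sys \<Rightarrow> 'b store \<Rightarrow> 'd event list set"
where
  "runs has_sort G ys u \<iota> I \<sigma> = {r. run has_sort (participants G) ys u \<iota> I \<sigma> r}"

definition event_input :: "'d event \<Rightarrow> 'd \<Rightarrow> bool" where
  "event_input ev d \<longleftrightarrow> (\<exists>p y. ev = EvIn p y d)"

definition label_input :: "('b val \<Rightarrow> 'd \<Rightarrow> bool) \<Rightarrow> 'b hlabel \<Rightarrow> 'd \<Rightarrow> bool" where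
  "label_input has_sort l d \<longleftrightarrow> (\<exists>y v. label_act l = AIn y v \<and> has_sort v d)"

definition label_value_sort :: "('b val \<Rightarrow> 'd \<Rightarrow> bool) \<Rightarrow> 'b hlabel \<Rightarrow> 'd \<Rightarrow> bool" where
  "label_value_sort has_sort l d \<longleftrightarrow>
     (\<exists>y v. (label_act l = AOut y v \<or> label_act l = AIn y v) \<and> has_sort v d)"

end

theory Submission
  imports Defs "HOL-Library.Multiset"
begin

text \<open>Each queue of a system is either free or bound by a restriction at some shared name.  The
  multiset of these binding statuses, paired with the contents of the queues, is invariant under
  structural congruence.  An implementation has queues bound at \<open>u\<close> only if its session is open,
  namely those on \<open>ys\<close>.  Every transition is a \<open>hook\<close> transition, and a communication revealed
  with session \<open>u\<close> is precisely one that appends to or removes from a queue bound at \<open>u\<close>.  So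
  comparing the queue contents that the rules for runs prescribe before and after a step
  determines whether the step is revealed, its direction, and its value.\<close>

section \<open>Binding status of queues and its invariance under congruence\<close>

text \<open>\<open>Inr u\<close> forgets the channel, so that renaming under the binder has no
  effect on it. A status that is already \<open>Inr\<close> is kept: the innermost binder counts, as
  in \<open>cross\<close>.\<close>

fun bind_status :: "chan list \<Rightarrow> shname \<Rightarrow> chan + shname \<Rightarrow> chan + shname" where
  "bind_status ys u (Inl y) = (if y \<in> set ys then Inr u else Inl y)"
| "bind_status ys u (Inr w) = Inr w"

primrec queues_of :: "'b sys \<Rightarrow> ((chan + shname) \<times> 'b val list) multiset" where
  "queues_of (Proc P) = {#}"
| "queues_of (Par S T) = queues_of S + queues_of T"
| "queues_of (Queue y vs) = {#(Inl y, vs)#}"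
| "queues_of (Res ys u S) = image_mset (map_prod (bind_status ys u) id) (queues_of S)"

definition queues_at :: "shname \<Rightarrow> 'b sys \<Rightarrow> 'b val list multiset" where
  "queues_at u S = image_mset snd (filter_mset (\<lambda>x. fst x = Inr u) (queues_of S))"

lemma queues_of_free: "(Inl y, q) \<in># queues_of S \<Longrightarrow> y \<in> fy_s S"
proof (induction S arbitrary: q)
  case (Res ys u S)
  then obtain k where k: "(k, q) \<in># queues_of S" "bind_status ys u k = Inl y" by auto
  then have "k = Inl y" "y \<notin> set ys" by (cases k; auto split: if_splits)+
  with k Res.IH show ?case by auto
qed auto

lemma queues_of_bound: "(Inr w, q) \<in># queues_of S \<Longrightarrow> w \<in> fn_s S"
proof (induction S arbitrary: q)
  case (Res ys u S)
  then obtain k where k: "(k, q) \<in># queues_of S" "bind_status ys u k = Inr w" by auto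
  then show ?case using Res.IH by (cases k) (auto split: if_splits)
qed auto

text \<open>This is scope extrusion: every free queue of \<open>S\<close> is on a channel of
  \<open>fy_s S\<close>, so the binder captures none of them.\<close>

lemma bind_status_disjoint:
  assumes "set ys \<inter> fy_s S = {}"
  shows "image_mset (map_prod (bind_status ys u) id) (queues_of S) = queues_of S"
proof -
  have "map_prod (bind_status ys u) id x = x" if "x \<in># queues_of S" for x
  proof (cases x)
    case (Pair k q)
    then show ?thesis using that queues_of_free assms by (cases k) auto
  qed
  then show ?thesis by (metis multiset.map_cong0 multiset.map_ident)
qed

lemma queues_of_swapy_s:
  "queues_of (swapy_s a b S) = image_mset (map_prod (map_sum (transpose a b) id) id) (queues_of S)"
proof (induction S)
  case (Res ys u S)
  have "bind_status (map (transpose a b) ys) u (map_sum (transpose a b) id k)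
      = map_sum (transpose a b) id (bind_status ys u k)" for k
    by (cases k) (auto simp: inj_image_mem_iff)
  then show ?case
    by (simp add: Res multiset.map_comp comp_def map_prod_def case_prod_beta id_def)
qed auto

lemma queues_of_scong: "scong S T \<Longrightarrow> queues_of S = queues_of T"
proof (induction rule: scong.induct)
  case (s_alpha a S b)
  \<comment> \<open>Neither \<open>a\<close> nor \<open>b\<close> is free in \<open>S\<close>, so
    the swap moves no status \<open>Inl y\<close> that occurs.\<close>
  have "map_prod (map_sum (transpose a b) id) id x = x" if "x \<in># queues_of S" for x
  proof (cases x)
    case (Pair k q)
    then show ?thesis using that s_alpha queues_of_free
      by (cases k) (auto intro!: transpose_apply_other)
  qed
  then show ?case unfolding queues_of_swapy_s by (metis multiset.map_cong0 multiset.map_ident)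
next
  case (s_res_comm ys zs u u' S)
  \<comment> \<open>No channel lies in both tuples, so at most one of the binders captures it,
    whatever their order.\<close>
  have "bind_status ys u (bind_status zs u' k) = bind_status zs u' (bind_status ys u k)" for k
    using s_res_comm by (cases k) auto
  then show ?case by (simp add: multiset.map_comp comp_def map_prod_def case_prod_beta)
qed (auto simp: bind_status_disjoint)

lemma queues_of_par: "queues_of (par Ss) = (\<Sum>S\<leftarrow>Ss. queues_of S)"
  by (induction Ss) (auto simp: par_def)

lemma queues_of_par_procs [simp]: "queues_of (par (map (\<lambda>x. Proc (f x)) xs)) = {#}"
  by (induction xs) (auto simp: par_def)

lemma queues_of_queues: "queues_of (queues ys w) = image_mset (\<lambda>y. (Inl y, w y)) (mset ys)"
  unfolding queues_def queues_of_par by (induction ys) auto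

lemma queues_of_open_session:
  "queues_of (Res ys u (Par (par (map (\<lambda>x. Proc (f x)) xs)) (queues ys w)))
    = image_mset (\<lambda>y. (Inr u, w y)) (mset ys)"
  by (auto simp: queues_of_queues multiset.map_comp intro!: image_mset_cong)

section \<open>Effect of hook transitions on queues\<close>

definition status_of :: "shname option \<Rightarrow> chan \<Rightarrow> chan + shname" where
  "status_of w y = (case w of None \<Rightarrow> Inl y | Some u \<Rightarrow> Inr u)"

lemma bind_status_status_of:
  "fy_a a = {y} \<Longrightarrow> bind_status ys u (status_of w y) = status_of (cross ys u w a) y"
  by (cases w) (auto simp: status_of_def)

text \<open>Contents change under \<open>Comm\<close> labels only; \<open>M\<close> collects the
  empty queues created by \<open>HInit\<close>.\<close>

lemma hook_Plain_queues:
  "hook S \<sigma> e l S' \<sigma>' \<Longrightarrow> l = Plain \<alpha> \<Longrightarrow>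
    \<exists>M. queues_of S' = queues_of S + M \<and> (\<forall>x \<in># M. snd x = [])"
proof (induction rule: hook.induct)
  case (HNew S \<sigma> e \<beta> S' \<sigma>' ys u)
  then obtain M where "queues_of S' = queues_of S + M" "\<forall>x \<in># M. snd x = []" by auto
  then show ?case
    by (intro exI[of _ "image_mset (map_prod (bind_status ys u) id) M"]) auto
next
  case (HInit ys \<sigma> u n P)
  show ?case
    \<comment> \<open>The queues created on \<open>ys\<close> lie under the new binder, hence their
      status is \<open>Inr u\<close>.\<close>
    by (intro exI[of _ "image_mset (\<lambda>y. (Inr u, [])) (mset ys)"])
      (auto simp: queues_of_queues multiset.map_comp simp del: upt_Suc intro!: image_mset_cong)
qed (auto simp: queues_of_scong)

text \<open>A communication touches a single queue, and at each restriction \<open>cross\<close>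
  updates the session component of the label just as \<open>bind_status\<close> updates the status
  of that queue.\<close>

lemma hook_Comm_queues:
  "hook S \<sigma> e l S' \<sigma>' \<Longrightarrow> l = Comm w a \<Longrightarrow>
    \<exists>y v q M. a = AOut y v \<and>
        queues_of S = add_mset (status_of w y, q) M \<and>
        queues_of S' = add_mset (status_of w y, q @ [v]) M
      \<or> a = AIn y v \<and>
        queues_of S = add_mset (status_of w y, v # q) M \<and>
        queues_of S' = add_mset (status_of w y, q) M"
proof (induction arbitrary: w rule: hook.induct)
  case (HNewComm S \<sigma> e w' a' S' \<sigma>' ys u)
  then have [simp]: "a' = a" and w: "w = cross ys u w' a" by auto
  let ?f = "map_prod (bind_status ys u) id :: _ \<times> 'b val list \<Rightarrow> _"
  obtain y v q M where
    "a = AOut y v \<and> queues_of S = add_mset (status_of w' y, q) M \<and>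
        queues_of S' = add_mset (status_of w' y, q @ [v]) M
      \<or> a = AIn y v \<and> queues_of S = add_mset (status_of w' y, v # q) M \<and>
        queues_of S' = add_mset (status_of w' y, q) M"
    using HNewComm.IH[of w'] by auto
  then show ?case
    by (intro exI[of _ y] exI[of _ v] exI[of _ q] exI[of _ "image_mset ?f M"])
      (auto simp: w bind_status_status_of)
next
  case (HPar S \<sigma> e l S' \<sigma>' T)
  then obtain y v q M where
    "a = AOut y v \<and> queues_of S = add_mset (status_of w y, q) M \<and>
        queues_of S' = add_mset (status_of w y, q @ [v]) M
      \<or> a = AIn y v \<and> queues_of S = add_mset (status_of w y, v # q) M \<and>
        queues_of S' = add_mset (status_of w y, q) M" by blast
  then show ?case
    by (intro exI[of _ y] exI[of _ v] exI[of _ q] exI[of _ "M + queues_of T"]) auto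
qed (auto simp: status_of_def queues_of_scong)

text \<open>The relation between \<open>l\<close> and \<alpha> lets the side conditions carry over:
  a plain label has the same action, and a \<open>Comm\<close> meets no condition on bound names or
  at a restriction.\<close>

lemma step_imp_hook:
  "step S \<sigma> e \<alpha> S' \<sigma>' \<Longrightarrow>
    \<exists>l. hook S \<sigma> e l S' \<sigma>' \<and> (l = Plain \<alpha> \<or> \<alpha> = ATau \<and> (\<exists>w a. l = Comm w a))"
proof (induction rule: step.induct)
  case (SInit ys \<sigma> u n P)
  then show ?case using HInit by blast
next
  case (SPar S \<sigma> e \<alpha> S' \<sigma>' T)
  then show ?case by (fastforce intro: HPar)
next
  case (SNew S \<sigma> e \<alpha> S' \<sigma>' ys u)
  then show ?case by (metis HNew HNewComm)
qed (blast intro: hook.intros)+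

section \<open>Queues bound at \<open>u\<close> in an implementation\<close>

lemma filter_bind_status:
  "w \<noteq> u \<Longrightarrow> filter_mset (\<lambda>x. fst x = Inr u) (image_mset (map_prod (bind_status zs w) id) M)
    = filter_mset (\<lambda>x. fst x = Inr u) M"
proof (induction M)
  case (add x M)
  then show ?case by (cases x; cases "fst x") auto
qed auto

text \<open>The component beside the hole does not have \<open>u\<close> free, hence has no queue
  bound at \<open>u\<close>, and the binders of the context are at other shared names.\<close>

lemma queues_at_in_ctx:
  assumes "in_ctx ys u H I"
  shows "queues_at u I = queues_at u H"
proof -
  obtain bs S where I: "scong I (foldr (\<lambda>(zs, w). Res zs w) bs (Par H S))"
    and bs: "u \<notin> snd ` set bs" and S: "u \<notin> fn_s S"
    using assms unfolding in_ctx_def by blast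
  have none: "filter_mset (\<lambda>x. fst x = Inr u) (queues_of S) = {#}"
    using S queues_of_bound by (fastforce simp flip: set_mset_eq_empty_iff)
  have ctx: "queues_at u (foldr (\<lambda>(zs, w). Res zs w) bs T) = queues_at u T" for T
    using bs by (induction bs) (auto simp: queues_at_def filter_bind_status)
  have "queues_at u I = queues_at u (Par H S)"
    using ctx[of "Par H S"] queues_of_scong[OF I] by (simp add: queues_at_def)
  also have "\<dots> = queues_at u H" by (simp add: queues_at_def none)
  finally show ?thesis .
qed

lemma queues_at_impl_None: "impl A ys u \<iota> None I \<Longrightarrow> queues_at u I = {#}"
  using queues_at_in_ctx by (fastforce simp: queues_at_def)

lemma queues_at_impl_Some:
  assumes "impl A ys u \<iota> (Some w) I"
  shows "queues_at u I = image_mset w (mset ys)"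
proof -
  obtain ps where
    "in_ctx ys u (Res ys u (Par (par (map (\<lambda>p. Proc (\<iota> p)) ps)) (queues ys w))) I"
    using assms by auto
  from queues_at_in_ctx[OF this] show ?thesis
    unfolding queues_at_def queues_of_open_session
    by (simp add: filter_mset_image_mset multiset.map_comp comp_def)
qed

text \<open>As \<open>ys\<close> is distinct, the update of \<open>w\<close> at \<open>y\<close>
  concerns exactly one queue; \<open>M\<close> holds the contents of the others.\<close>

lemma queues_at_impl_update:
  assumes "impl A ys u \<iota> (Some w) I" "impl A ys u \<iota>' (Some (w(y := q))) I'"
    and "distinct ys" "y \<in> set ys"
  obtains M where "queues_at u I = add_mset (w y) M" "queues_at u I' = add_mset q M"
proof -
  define N where "N = mset (remove1 y ys)"
  have N: "mset ys = add_mset y N" using assms(4) by (simp add: N_def)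
  have "y \<notin># N"
    unfolding N_def set_mset_mset using assms(3) by (simp add: set_remove1_eq)
  then have "image_mset (w(y := q)) N = image_mset w N"
    by (auto intro!: image_mset_cong)
  with that[of "image_mset w N"] N show ?thesis
    using queues_at_impl_Some[OF assms(1)] queues_at_impl_Some[OF assms(2)] by simp
qed

section \<open>Reading the label off the change of the queues\<close>

lemma revealed_iff: "\<not> is_tau l \<and> \<not> external u l \<longleftrightarrow> (\<exists>a. l = Comm (Some u) a)"
  by (cases l) (auto simp: is_tau_def external_def)

lemma hook_revealed_cases:
  assumes "hook S \<sigma> e (Comm (Some u) a) S' \<sigma>'"
  obtains y v q M where "a = AOut y v"
      "queues_at u S = add_mset q M" "queues_at u S' = add_mset (q @ [v]) M"
  | y v q M where "a = AIn y v"
      "queues_at u S = add_mset (v # q) M" "queues_at u S' = add_mset q M"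
  using hook_Comm_queues[OF assms refl] by (auto simp: queues_at_def status_of_def)

text \<open>A plain step can open a further session at \<open>u\<close>, which adds empty queues; a
  \<open>Comm\<close> of another status leaves the queues bound at \<open>u\<close> alone.\<close>

lemma hook_unrevealed_queues_at:
  assumes h: "hook S \<sigma> e l S' \<sigma>'" and l: "\<nexists>a. l = Comm (Some u) a"
  shows "\<exists>M. queues_at u S' = queues_at u S + M \<and> (\<forall>q \<in># M. q = [])"
proof (cases l)
  case (Plain \<alpha>)
  with hook_Plain_queues[OF h] obtain M
    where "queues_of S' = queues_of S + M" "\<forall>x \<in># M. snd x = []" by blast
  then show ?thesis unfolding queues_at_def
    by (intro exI[of _ "image_mset snd (filter_mset (\<lambda>x. fst x = Inr u) M)"]) auto
next
  case (Comm w a)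
  with l have "status_of w y \<noteq> Inr u" for y by (auto simp: status_of_def split: option.splits)
  then have "queues_at u S' = queues_at u S"
    using hook_Comm_queues[OF h Comm] by (auto simp: queues_at_def)
  then show ?thesis by simp
qed

lemma silent_step:
  assumes "step S \<sigma> e \<alpha> S' \<sigma>'" and "queues_at u S = {#} \<or> queues_at u S' = queues_at u S"
  obtains l where "hook S \<sigma> e l S' \<sigma>'" "is_tau l \<or> external u l"
proof -
  obtain l where h: "hook S \<sigma> e l S' \<sigma>'" using step_imp_hook[OF assms(1)] by blast
  \<comment> \<open>A revealed step needs a queue bound at \<open>u\<close> and changes its
    contents, against either alternative of the assumption.\<close>
  have False if "l = Comm (Some u) a" for a
    by (rule hook_revealed_cases[OF h[unfolded that]]) (use assms(2) in auto)
  with that h revealed_iff[of l u] show ?thesis by blast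
qed

abbreviation total_length :: "'a list multiset \<Rightarrow> nat" where
  "total_length M \<equiv> \<Sum>\<^sub># (image_mset length M)"

text \<open>Total lengths are compared, rather than multisets, because they ignore the empty queues
  that an unrevealed step may add.\<close>

lemma length_changing_step:
  assumes "step S \<sigma> e \<alpha> S' \<sigma>'" and "total_length (queues_at u S') \<noteq> total_length (queues_at u S)"
  obtains a where "hook S \<sigma> e (Comm (Some u) a) S' \<sigma>'"
proof -
  obtain l where h: "hook S \<sigma> e l S' \<sigma>'" using step_imp_hook[OF assms(1)] by blast
  have "\<exists>a. l = Comm (Some u) a"
  proof (rule ccontr)
    assume "\<nexists>a. l = Comm (Some u) a"
    from hook_unrevealed_queues_at[OF h this] obtain M
      where "queues_at u S' = queues_at u S + M" "\<forall>q \<in># M. q = []" by blast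
    with assms(2) show False by simp
  qed
  with h that show ?thesis by blast
qed

text \<open>This recovers the contents touched by a revealed step from the multisets before and
  after it. Adding crosswise and cancelling leaves \<open>{#a, b'#} = {#a', b#}\<close>.\<close>

lemma add_mset_exchange:
  assumes "add_mset a M = add_mset b N" "add_mset a' M = add_mset b' N" "a \<noteq> a'"
  shows "a = b \<and> a' = b'"
proof -
  have "{#a, b'#} + M = {#b, b'#} + N" using assms(1) by simp
  also have "\<dots> = {#a', b#} + M" using assms(2) by (simp add: add_mset_commute)
  finally have "{#a, b'#} = {#a', b#}" by (simp only: add_right_cancel)
  with assms(3) show ?thesis by (auto simp: add_eq_conv_ex)
qed

text \<open>The channel is only existential, since the status \<open>Inr u\<close> does not record
  it and alpha-conversion may have renamed it.\<close>

lemma output_step: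
  assumes "step S \<sigma> e \<alpha> S' \<sigma>'"
    and S: "queues_at u S = add_mset q M" and S': "queues_at u S' = add_mset (q @ [v]) M"
  obtains y where "hook S \<sigma> e (Comm (Some u) (AOut y v)) S' \<sigma>'"
proof -
  obtain a where h: "hook S \<sigma> e (Comm (Some u) a) S' \<sigma>'"
    using length_changing_step[OF assms(1), of u] S S' by auto
  from h show ?thesis
  proof (cases rule: hook_revealed_cases)
    case (1 y v' q' M')
    \<comment> \<open>Both descriptions replace one queue, so \<open>q' = q\<close> and
      \<open>q' @ [v'] = q @ [v]\<close>, whence \<open>v' = v\<close>.\<close>
    then show ?thesis
      using add_mset_exchange[of q M q' M' "q @ [v]" "q' @ [v']"] S S' h that by auto
  next
    case (2 y v' q' M')
    \<comment> \<open>An input would decrease the total length, whereas appending \<open>v\<close>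
      increases it.\<close>
    then have "total_length (queues_at u S') < total_length (queues_at u S)" by simp
    with S S' show ?thesis by simp
  qed
qed

lemma input_step:
  assumes "step S \<sigma> e \<alpha> S' \<sigma>'"
    and S: "queues_at u S = add_mset (v # q) M" and S': "queues_at u S' = add_mset q M"
  obtains y where "hook S \<sigma> e (Comm (Some u) (AIn y v)) S' \<sigma>'"
proof -
  obtain a where h: "hook S \<sigma> e (Comm (Some u) a) S' \<sigma>'"
    using length_changing_step[OF assms(1), of u] S S' by auto
  from h show ?thesis
  proof (cases rule: hook_revealed_cases)
    case (2 y v' q' M')
    then show ?thesis
      using add_mset_exchange[of "v # q" M "v' # q'" M' q q'] S S' h that by auto
  next
    case (1 y v' q' M')
    then have "total_length (queues_at u S) < total_length (queues_at u S')" by simp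
    with S S' show ?thesis by simp
  qed
qed

section \<open>Simulation of runs by hook sequences\<close>

definition matches :: "('b val \<Rightarrow> 'd \<Rightarrow> bool) \<Rightarrow> 'd event \<Rightarrow> 'b hlabel \<Rightarrow> bool" where
  "matches has_sort ev l \<longleftrightarrow>
     (event_input ev (event_sort ev) \<longleftrightarrow> label_input has_sort l (event_sort ev)) \<and>
     label_value_sort has_sort l (event_sort ev)"

text \<open>The bijection is represented by the increasing list of the positions of the revealed
  labels.\<close>

definition simulated ::
  "('b val \<Rightarrow> 'd \<Rightarrow> bool) \<Rightarrow> shname \<Rightarrow> 'b sys \<Rightarrow> 'b store \<Rightarrow> 'd event list \<Rightarrow> bool" where
  "simulated has_sort u I \<sigma> r \<longleftrightarrow> (\<exists>n S s e \<alpha>. S 0 = I \<and> s 0 = \<sigma> \<and>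
     (\<forall>j \<in> {1..n}. hook (S (j - 1)) (s (j - 1)) (e j) (\<alpha> j) (S j) (s j)) \<and>
     list_all2 (matches has_sort) r
       (map \<alpha> (filter (\<lambda>j. \<not> is_tau (\<alpha> j) \<and> \<not> external u (\<alpha> j)) [1..<Suc n])))"

lemma simulated_Nil: "simulated has_sort u I \<sigma> []"
  unfolding simulated_def
  by (intro exI[of _ 0] exI[of _ "\<lambda>_. I"] exI[of _ "\<lambda>_. \<sigma>"] exI) simp

text \<open>Silent steps and events are treated together, so that positions are renumbered only
  once.\<close>

lemma simulated_prepend:
  assumes h: "hook I \<sigma> e l I' \<sigma>'" and sim: "simulated has_sort u I' \<sigma>' r"
    and r': "if is_tau l \<or> external u l then r' = r else \<exists>ev. r' = ev # r \<and> matches has_sort ev l"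
  shows "simulated has_sort u I \<sigma> r'"
proof -
  obtain n S s e' \<alpha> where 0: "S 0 = I'" "s 0 = \<sigma>'"
    and hs: "\<forall>j \<in> {1..n}. hook (S (j - 1)) (s (j - 1)) (e' j) (\<alpha> j) (S j) (s j)"
    and m: "list_all2 (matches has_sort) r
      (map \<alpha> (filter (\<lambda>j. \<not> is_tau (\<alpha> j) \<and> \<not> external u (\<alpha> j)) [1..<Suc n]))"
    using sim unfolding simulated_def by blast
  \<comment> \<open>States are numbered from 0 and labels from 1: the new state goes to 0, the new
    label to 1, and all old ones move up by one.\<close>
  define S' where "S' = case_nat I S"
  define s' where "s' = case_nat \<sigma> s"
  define e'' where "e'' = (\<lambda>j. if j = Suc 0 then e else e' (j - 1))"
  define \<alpha>' where "\<alpha>' = (\<lambda>j. if j = Suc 0 then l else \<alpha> (j - 1))"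
  have hs': "hook (S' (j - 1)) (s' (j - 1)) (e'' j) (\<alpha>' j) (S' j) (s' j)" if "j \<in> {1..Suc n}" for j
  proof (cases "j = 1")
    case True
    with h 0 show ?thesis by (simp add: S'_def s'_def e''_def \<alpha>'_def)
  next
    case False
    with that obtain k where k: "j = Suc (Suc k)" "Suc k \<in> {1..n}"
      by (metis One_nat_def atLeastAtMost_iff not0_implies_Suc not_less_eq_eq le0)
    with hs have "hook (S k) (s k) (e' (Suc k)) (\<alpha> (Suc k)) (S (Suc k)) (s (Suc k))" by fastforce
    with k show ?thesis by (simp add: S'_def s'_def e''_def \<alpha>'_def)
  qed
  let ?P = "\<lambda>l. \<not> is_tau l \<and> \<not> external u l"
  have "[1..<Suc (Suc n)] = 1 # map Suc [1..<Suc n]"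
    by (simp add: upt_conv_Cons map_Suc_upt del: upt_Suc)
  moreover have "map \<alpha>' (filter (\<lambda>j. ?P (\<alpha>' j)) (map Suc [1..<Suc n]))
      = map \<alpha> (filter (\<lambda>j. ?P (\<alpha> j)) [1..<Suc n])"
  proof -
    have "map \<alpha>' (map Suc [1..<Suc n]) = map \<alpha> [1..<Suc n]" by (auto simp: \<alpha>'_def)
    \<comment> \<open>Filtering the labels instead of their positions makes the shift by
      \<open>Suc\<close> disappear.\<close>
    then have "filter ?P (map \<alpha>' (map Suc [1..<Suc n])) = filter ?P (map \<alpha> [1..<Suc n])" by metis
    then show ?thesis by (simp only: filter_map comp_def)
  qed
  moreover have "\<alpha>' 1 = l" by (simp add: \<alpha>'_def)
  ultimately have "list_all2 (matches has_sort) r'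
      (map \<alpha>' (filter (\<lambda>j. ?P (\<alpha>' j)) [1..<Suc (Suc n)]))"
    using m r' by (auto simp del: upt_Suc simp: list_all2_Cons2 split: if_splits)
  moreover have "S' 0 = I" "s' 0 = \<sigma>" by (simp_all add: S'_def s'_def)
  ultimately show ?thesis unfolding simulated_def using hs' by blast
qed

lemma simulated_silent:
  assumes "step I \<sigma> e \<alpha> I' \<sigma>'" "queues_at u I = {#} \<or> queues_at u I' = queues_at u I"
    and "simulated has_sort u I' \<sigma>' r"
  shows "simulated has_sort u I \<sigma> r"
  using silent_step[OF assms(1,2)] simulated_prepend[OF _ assms(3)] by metis

lemma simulated_event:
  assumes "hook I \<sigma> e (Comm (Some u) a) I' \<sigma>'" "matches has_sort ev (Comm (Some u) a)"
    and "simulated has_sort u I' \<sigma>' r"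
  shows "simulated has_sort u I \<sigma> (ev # r)"
  using simulated_prepend[OF assms(1,3)] assms(2) revealed_iff by metis

text \<open>Processes and the context contribute no queue bound at \<open>u\<close>, so
  \<open>q\<close> alone fixes the multiset.\<close>

lemma queues_at_impl_cong:
  "impl A ys u \<iota> q I \<Longrightarrow> impl A ys u \<iota>' q I' \<Longrightarrow> queues_at u I' = queues_at u I"
  by (cases q) (simp_all only: queues_at_impl_None queues_at_impl_Some)

text \<open>\<open>RSnd\<close> and \<open>RRcv\<close> prescribe a queue change that forces a
  revealed communication. \<open>RExt1\<close> and \<open>RExt2\<close> keep \<open>q\<close>, and
  \<open>ROpen\<close> starts without queues bound at \<open>u\<close>, so these steps add no
  event.\<close>

lemma run_imp_simulated:
  assumes "run has_sort A ys u \<iota> I \<sigma> r" and "distinct ys"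
  shows "simulated has_sort u I \<sigma> r"
  using assms(1)
proof induction
  case REnd
  show ?case by (rule simulated_Nil)
next
  case (RSnd \<iota> w I p \<sigma> e y v P d I' r)
  obtain M where "queues_at u I = add_mset (w y) M" "queues_at u I' = add_mset (w y @ [v]) M"
    using queues_at_impl_update[OF RSnd(1,7) \<open>distinct ys\<close> RSnd(4)] .
  from output_step[OF RSnd(6) this] obtain y'
    where "hook I \<sigma> e (Comm (Some u) (AOut y' v)) I' \<sigma>" .
  \<comment> \<open>Only the direction and the sort of the value are compared, so \<open>y'\<close>
    may differ from \<open>y\<close>.\<close>
  moreover have "matches has_sort (EvOut p y d) (Comm (Some u) (AOut y' v))"
    using RSnd(5)
    by (auto simp: matches_def event_input_def label_input_def label_value_sort_def)
  ultimately show ?case using RSnd.IH by (rule simulated_event)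
next
  case (RRcv \<iota> w I p \<sigma> e y v P \<sigma>' d vs I' r)
  obtain M where "queues_at u I = add_mset (v # vs) M" "queues_at u I' = add_mset vs M"
    using queues_at_impl_update[OF RRcv(1,8) \<open>distinct ys\<close> RRcv(4)] RRcv(6) by metis
  from input_step[OF RRcv(7) this] obtain y'
    where "hook I \<sigma> e (Comm (Some u) (AIn y' v)) I' \<sigma>'" .
  moreover have "matches has_sort (EvIn p y d) (Comm (Some u) (AIn y' v))"
    using RRcv(5)
    by (auto simp: matches_def event_input_def label_input_def label_value_sort_def)
  ultimately show ?case using RRcv.IH by (rule simulated_event)
next
  case RExt1
  then show ?case using simulated_silent queues_at_impl_cong by blast
next
  case RExt2
  then show ?case using simulated_silent queues_at_impl_cong by blast
next
  case ROpen
  then show ?case using simulated_silent queues_at_impl_None by blast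
qed

section \<open>The order-preserving bijection\<close>

theorem theorem6p5:
  fixes has_sort :: "'b val \<Rightarrow> 'd \<Rightarrow> bool"
    and G :: "'d gtype" and ys :: "chan list" and u :: shname
    and \<iota> :: "part \<Rightarrow> 'b proc" and I :: "'b sys" and \<sigma> :: "'b store"
    and r :: "'d event list"
  assumes "global_type ys G"
    and "implementation G ys u \<iota> I"
    and "r \<in> runs has_sort G ys u \<iota> I \<sigma>"
  shows "\<exists>(n::nat) (S :: nat \<Rightarrow> 'b sys) (s :: nat \<Rightarrow> 'b store)
            (e :: nat \<Rightarrow> 'b expr) (\<alpha> :: nat \<Rightarrow> 'b hlabel) (\<chi> :: nat \<Rightarrow> nat).
     S 0 = I \<and> s 0 = \<sigma> \<and>
     (\<forall>j \<in> {1..n}. hook (S (j - 1)) (s (j - 1)) (e j) (\<alpha> j) (S j) (s j)) \<and>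
     bij_betw \<chi> {1..length r} {j \<in> {1..n}. \<not> is_tau (\<alpha> j) \<and> \<not> external u (\<alpha> j)} \<and>
     strict_mono_on {1..length r} \<chi> \<and>
     (\<forall>i \<in> {1..length r}. \<forall>d. event_sort (r ! (i - 1)) = d \<longrightarrow>
        (event_input (r ! (i - 1)) d \<longleftrightarrow> label_input has_sort (\<alpha> (\<chi> i)) d) \<and>
        label_value_sort has_sort (\<alpha> (\<chi> i)) d)"
proof -
  have "simulated has_sort u I \<sigma> r"
    using assms(1,3) run_imp_simulated unfolding global_type_def runs_def by blast
  then obtain n S s e \<alpha> where 0: "S 0 = I" "s 0 = \<sigma>"
    and hs: "\<forall>j \<in> {1..n}. hook (S (j - 1)) (s (j - 1)) (e j) (\<alpha> j) (S j) (s j)"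
    and m: "list_all2 (matches has_sort) r
      (map \<alpha> (filter (\<lambda>j. \<not> is_tau (\<alpha> j) \<and> \<not> external u (\<alpha> j)) [1..<Suc n]))"
    unfolding simulated_def by blast
  define js where "js = filter (\<lambda>j. \<not> is_tau (\<alpha> j) \<and> \<not> external u (\<alpha> j)) [1..<Suc n]"
  \<comment> \<open>Events are counted from 1, list indices from 0.\<close>
  define \<chi> where "\<chi> = (\<lambda>i. js ! (i - 1))"
  have len: "length r = length js"
    using list_all2_lengthD[OF m] by (simp add: js_def)
  \<comment> \<open>Strict sortedness yields both the monotonicity of \<chi> and the distinctness
    behind its injectivity.\<close>
  have sorted: "sorted_wrt (<) js"
    unfolding js_def by (intro sorted_wrt_filter) (rule sorted_wrt_upt)
  have js: "set js = {j \<in> {1..n}. \<not> is_tau (\<alpha> j) \<and> \<not> external u (\<alpha> j)}"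
    by (auto simp: js_def simp del: upt_Suc)
  have mono: "strict_mono_on {1..length r} \<chi>"
    unfolding \<chi>_def
    by (rule strict_mono_onI) (auto simp: len intro!: sorted_wrt_nth_less[OF sorted])
  have "bij_betw (\<lambda>i. i - 1) {1..length js} {..<length js}"
    by (rule bij_betw_byWitness[where f' = Suc]) auto
  moreover have "bij_betw ((!) js) {..<length js} (set js)"
    using sorted by (intro bij_betw_nth) (auto simp: strict_sorted_iff)
  ultimately have "bij_betw \<chi> {1..length r} (set js)"
    using bij_betw_trans unfolding \<chi>_def len by (fastforce simp: comp_def)
  moreover have "matches has_sort (r ! (i - 1)) (\<alpha> (\<chi> i))" if "i \<in> {1..length r}" for i
    using list_all2_nthD[OF m[folded js_def], of "i - 1"] that len by (auto simp: \<chi>_def)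
  ultimately show ?thesis
    using 0 hs mono unfolding js matches_def by blast
qed

end
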